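(* (Order-invariant optimality of autoregressive pathfinding policies.) Let $n\ge 1$ agents act simultaneously in the environment. For any permutation $\sigma\in S_n$, an autoregressive policy can be defined as $$\pi^{\sigma}_\theta(a^{1:n}\mid \bm{o})\stackrel{\text{def}}{=}\prod_{k=1}^{n}\pi_\theta\big(a^{\sigma[k]}\mid \bm{o}, a^{\sigma[1]},\ldots,a^{\sigma[k-1]}\big),$$ where $S_n$ is the set of all possible permutations of $n$ elements, $\sigma[k]$ is the $k$-th element of the permutation $\sigma$, and $\theta$ is the policy parameter. Then $$\forall \bm{o}\in O^n,\ \forall \sigma,\nu\in S_n:\qquad \pi^{\sigma}_{\theta}(\cdot\mid \bm{o})=\pi^{\nu}_{\theta}(\cdot\mid \bm{o}).$$ Let $f(\cdot)$ denote any objective function that depends only on the induced autoregressive pathfinding policy. Then $$\forall \sigma,\nu\in S_n:\qquad \sup_{\theta} f\big(\pi^{\sigma}_{\theta}\big)=\sup_{\theta} f\big(\pi^{\nu}_{\theta}\big).$$ Consequently, the optimal makespan in one-shot multi-agent path finding, or the optimal throughput in lifelong multi-agent path finding, attained by autoregressive policies is independent of the decision order $\sigma$.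
   Context: Environment: a decentralized partially observable Markov decision process with agents $\{1,\dots,n\}$, state set $S$, individual action set $A$, individual observation set $O$ and transition function $P(s'\mid s,\bm{a})$ for joint actions $\bm{a}\in A^n$. At each discrete timestep each agent $i$ receives an observation $o^i\in O$ from the global state, forming the joint observation $\bm{o}=(o^1,\dots,o^n)\in O^n$; the agents choose a joint action $a^{1:n}=(a^1,\dots,a^n)\in A^n$, and the state then evolves according to $P$. Notation: $\pi_\theta\big(a^{\sigma[k]}\mid \bm{o}, a^{\sigma[1]},\ldots,a^{\sigma[k-1]}\big)$ is the probability that the policy with parameter $\theta$ assigns to action $a^{\sigma[k]}$ for agent $\sigma[k]$, given the joint observation and the actions already chosen by the agents $\sigma[1],\dots,\sigma[k-1]$ preceding it in the decision order $\sigma$. Multi-agent path finding: agents move on a graph, at each timestep either staying in place or moving to a neighboring vertex, and have to reach goal vertices by collision-free paths. In the one-shot problem each agent has a single goal, and the makespan is the time until all agents are on their goals. In the lifelong problem an agent that reaches its goal is immediately assigned a new one, and the throughput is the total number of goals reached divided by the total number of timesteps.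
   Formalization: It is assumed that, for each θ, the factors π_θ(a^{σ[k]} | o, a^{σ[1]},…) are the conditional probabilities of one joint distribution on A^n given o (unconstrained on null histories); for arbitrary, unrelated factors the claimed order invariance fails already for n = 2. *)

theory Defs
  imports "HOL-Probability.Probability" "HOL-Combinatorics.Multiset_Permutations"
begin

section \<open>Autoregressive policies\<close>

text \<open>
  The agents are the elements of a finite type \<open>'n\<close>, so \<open>n = CARD('n) \<ge> 1\<close>; joint observations
  and joint actions are functions \<open>'n \<Rightarrow> 'o\<close> and \<open>'n \<Rightarrow> 'a\<close>. A decision order is a
  duplicate-free list of all agents, an element of \<open>permutations_of_set UNIV\<close>.

  For a policy \<open>p\<close>, \<open>p obs h i\<close> is the distribution of the action of agent \<open>i\<close> given the joint
  observation \<open>obs\<close> and the list \<open>h\<close> of the decisions taken so far, each labelled with the agent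
  that took it.
\<close>

type_synonym ('n, 'a, 'o) policy = "('n \<Rightarrow> 'o) \<Rightarrow> ('n \<times> 'a) list \<Rightarrow> 'n \<Rightarrow> 'a pmf"

type_synonym ('n, 'a, 'o) joint_policy = "('n \<Rightarrow> 'o) \<Rightarrow> ('n \<Rightarrow> 'a) pmf"

text \<open>
  The factors \<open>\<pi>\<^sub>\<theta>(a\<^sup>i | o, h)\<close> are conditional probabilities of one and the same distribution
  \<open>\<pi>\<^sub>\<theta>(\<cdot> | o)\<close> on joint actions. For unrelated factors the order invariance is false already
  for two agents. Nothing is required of \<open>p obs h i\<close> when the history \<open>h\<close> has probability zero.
\<close>

definition conditionals_of ::
  "('n::finite, 'a, 'o) joint_policy \<Rightarrow> ('n, 'a, 'o) policy \<Rightarrow> bool" where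
  "conditionals_of q p \<longleftrightarrow>
    (\<forall>obs h i x. distinct (map fst h) \<and> i \<notin> fst ` set h \<and>
       \<P>(b in q obs. \<forall>(j, y)\<in>set h. b j = y) > 0 \<longrightarrow>
       pmf (p obs h i) x = \<P>(b in q obs. b i = x \<bar> \<forall>(j, y)\<in>set h. b j = y))"

definition coherent :: "('n::finite, 'a, 'o) policy \<Rightarrow> bool" where
  "coherent p \<longleftrightarrow> (\<exists>q. conditionals_of q p)"

definition autoregressive_prob ::
  "('n::finite, 'a, 'o) policy \<Rightarrow> 'n list \<Rightarrow> ('n \<Rightarrow> 'o) \<Rightarrow> ('n \<Rightarrow> 'a) \<Rightarrow> real" where
  "autoregressive_prob p \<sigma> obs a =
    (\<Prod>k<CARD('n). pmf (p obs (map (\<lambda>i. (i, a i)) (take k \<sigma>)) (\<sigma> ! k)) (a (\<sigma> ! k)))"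

definition autoregressive ::
  "('n::finite, 'a, 'o) policy \<Rightarrow> 'n list \<Rightarrow> ('n, 'a, 'o) joint_policy" where
  "autoregressive p \<sigma> obs = embed_pmf (autoregressive_prob p \<sigma> obs)"

text \<open>
  For every policy and every decision order the product is a probability mass function, so
  \<open>embed_pmf\<close> above is meaningful. It is the law of sequential sampling.
\<close>

primrec sample_seq ::
  "(('n \<times> 'a) list \<Rightarrow> 'n \<Rightarrow> 'a pmf) \<Rightarrow> ('n \<times> 'a) list \<Rightarrow> 'n list \<Rightarrow> ('n \<Rightarrow> 'a) pmf" where
  "sample_seq r h [] = return_pmf (\<lambda>_. undefined)"
| "sample_seq r h (i # is) =
    bind_pmf (r h i) (\<lambda>x. map_pmf (\<lambda>b. b(i := x)) (sample_seq r (h @ [(i, x)]) is))"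

lemma sample_seq_undefined:
  "b \<in> set_pmf (sample_seq r h is) \<Longrightarrow> j \<notin> set is \<Longrightarrow> b j = undefined"
  by (induction "is" arbitrary: h b) auto

lemma pmf_sample_seq:
  assumes "distinct is" "\<And>j. j \<notin> set is \<Longrightarrow> a j = undefined"
  shows "pmf (sample_seq r h is) a =
    (\<Prod>k<length is. pmf (r (h @ map (\<lambda>i. (i, a i)) (take k is)) (is ! k)) (a (is ! k)))"
  using assms
proof (induction "is" arbitrary: h a)
  case Nil
  then have "a = (\<lambda>_. undefined)" by auto
  then show ?case by simp
next
  case (Cons i js)
  let ?a = "a(i := undefined)"
  let ?S = "\<lambda>x. sample_seq r (h @ [(i, x)]) js"
  have eq: "pmf (map_pmf (\<lambda>b. b(i := x)) (?S x)) a = indicator {a i} x * pmf (?S (a i)) ?a" for x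
  proof (cases "x = a i")
    case True
    have "pmf (map_pmf (\<lambda>b. b(i := x)) (?S x)) a
        = measure (?S x) ((\<lambda>b. b(i := x)) -` {a})"
      by (simp add: pmf_map)
    also have "\<dots> = measure (?S x) {?a}"
    proof (rule measure_pmf.finite_measure_eq_AE)
      show "AE b in ?S x. b \<in> (\<lambda>b. b(i := x)) -` {a} \<longleftrightarrow> b \<in> {?a}"
      proof (rule AE_pmfI)
        fix b assume "b \<in> set_pmf (?S x)"
        then have "b i = undefined"
          using sample_seq_undefined Cons.prems(1) by fastforce
        then show "b \<in> (\<lambda>b. b(i := x)) -` {a} \<longleftrightarrow> b \<in> {?a}"
          using True by (auto simp: fun_eq_iff)
      qed
    qed auto
    finally show ?thesis using True by (simp add: measure_pmf_single)
  next
    case False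
    have "(\<lambda>b. b(i := x)) -` {a} = {}" using False by auto
    then show ?thesis using False by (simp add: pmf_map)
  qed
  have "pmf (sample_seq r h (i # js)) a
      = (\<integral>x. indicator {a i} x * pmf (?S (a i)) ?a \<partial>measure_pmf (r h i))"
    by (simp add: pmf_bind eq)
  also have "\<dots> = pmf (r h i) (a i) * pmf (?S (a i)) ?a"
    by (simp add: measure_pmf_single)
  also have "pmf (?S (a i)) ?a = (\<Prod>k<length js.
      pmf (r ((h @ [(i, a i)]) @ map (\<lambda>j. (j, ?a j)) (take k js)) (js ! k)) (?a (js ! k)))"
    by (rule Cons.IH) (use Cons.prems in auto)
  also have "\<dots> = (\<Prod>k<length js.
      pmf (r ((h @ [(i, a i)]) @ map (\<lambda>j. (j, a j)) (take k js)) (js ! k)) (a (js ! k)))"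
  proof (rule prod.cong[OF refl])
    fix k assume k: "k \<in> {..<length js}"
    have "map (\<lambda>j. (j, ?a j)) (take k js) = map (\<lambda>j. (j, a j)) (take k js)"
      using Cons.prems(1) by (auto dest: in_set_takeD)
    moreover have "?a (js ! k) = a (js ! k)"
      using Cons.prems(1) k by auto
    ultimately show "pmf (r ((h @ [(i, a i)]) @ map (\<lambda>j. (j, ?a j)) (take k js)) (js ! k)) (?a (js ! k))
      = pmf (r ((h @ [(i, a i)]) @ map (\<lambda>j. (j, a j)) (take k js)) (js ! k)) (a (js ! k))"
      by (simp only:)
  qed
  finally show ?case
    by (simp add: prod.lessThan_Suc_shift del: prod.lessThan_Suc)
qed

lemma pmf_autoregressive:
  fixes p :: "('n::finite, 'a, 'o) policy"
  assumes "\<sigma> \<in> permutations_of_set UNIV"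
  shows "pmf (autoregressive p \<sigma> obs) a = autoregressive_prob p \<sigma> obs a"
proof -
  have \<sigma>: "distinct \<sigma>" "set \<sigma> = UNIV"
    using assms by (auto simp: permutations_of_set_def)
  then have "length \<sigma> = CARD('n)"
    by (metis distinct_card)
  then have "pmf (sample_seq (p obs) [] \<sigma>) x = autoregressive_prob p \<sigma> obs x" for x
    using \<sigma> pmf_sample_seq[of \<sigma> x "p obs" "[]"] by (simp add: autoregressive_prob_def)
  then have "pmf (sample_seq (p obs) [] \<sigma>) = autoregressive_prob p \<sigma> obs"
    by (rule ext)
  then have "autoregressive p \<sigma> obs = sample_seq (p obs) [] \<sigma>"
    using type_definition.Rep_inverse[OF td_pmf_embed_pmf, of "sample_seq (p obs) [] \<sigma>"]
    by (simp add: autoregressive_def)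
  then show ?thesis
    using \<open>pmf (sample_seq (p obs) [] \<sigma>) = _\<close> by simp
qed


section \<open>The environment\<close>

text \<open>The observation kernel covers deterministic observations through \<open>return_pmf\<close>.\<close>

record ('n, 's, 'a, 'o) dec_pomdp =
  init :: "'s pmf"
  trans :: "'s \<Rightarrow> ('n \<Rightarrow> 'a) \<Rightarrow> 's pmf"
  observe :: "'s \<Rightarrow> ('n \<Rightarrow> 'o) pmf"

definition state_step ::
  "('n, 's, 'a, 'o, 'z) dec_pomdp_scheme \<Rightarrow> ('n, 'a, 'o) joint_policy \<Rightarrow> 's \<Rightarrow> 's pmf" where
  "state_step E q s =
    bind_pmf (observe E s) (\<lambda>obs. bind_pmf (q obs) (\<lambda>a. trans E s a))"

definition state_kernel ::
  "('n, 's, 'a, 'o, 'z) dec_pomdp_scheme \<Rightarrow> ('n, 'a, 'o) joint_policy \<Rightarrow>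
    nat \<Rightarrow> (nat \<Rightarrow> 's) \<Rightarrow> 's measure" where
  "state_kernel E q t \<omega> =
    measure_pmf (case t of 0 \<Rightarrow> init E | Suc u \<Rightarrow> state_step E q (\<omega> u))"

text \<open>
  The law of the infinite state trajectory, by the Ionescu-Tulcea construction of the library.
\<close>

definition trajectories ::
  "('n, 's, 'a, 'o, 'z) dec_pomdp_scheme \<Rightarrow> ('n, 'a, 'o) joint_policy \<Rightarrow>
    (nat \<Rightarrow> 's) measure" where
  "trajectories E q =
    projective_family.lim UNIV
      (Ionescu_Tulcea.CI (state_kernel E q) (\<lambda>_. count_space UNIV)) (\<lambda>_. count_space UNIV)"

lemma Ionescu_Tulcea_state_kernel:
  "Ionescu_Tulcea (state_kernel E q) (\<lambda>_. count_space UNIV)"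
proof (rule Ionescu_Tulcea.intro)
  fix i :: nat
  show "state_kernel E q i \<in> measurable (PiM {0..<i} (\<lambda>_. count_space UNIV))
      (subprob_algebra (count_space UNIV))"
  proof (cases i)
    case 0
    then have "state_kernel E q i = (\<lambda>_. measure_pmf (init E))"
      by (simp add: state_kernel_def fun_eq_iff)
    then show ?thesis
      by (simp add: measure_pmf_in_subprob_algebra)
  next
    case (Suc u)
    have "(\<lambda>\<omega>. \<omega> u) \<in> measurable (PiM {0..<i} (\<lambda>_. count_space UNIV)) (count_space UNIV)"
      using Suc by (intro measurable_component_singleton) auto
    then show ?thesis
      unfolding state_kernel_def Suc nat.case
      by (rule measurable_compose) (auto simp: measure_pmf_in_subprob_algebra)
  qed
next
  fix i x show "prob_space (state_kernel E q i x)"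
    by (simp add: state_kernel_def measure_pmf.prob_space_axioms)
qed

lemma sets_trajectories [measurable_cong]:
  "sets (trajectories E q) = sets (PiM UNIV (\<lambda>_. count_space UNIV))"
proof -
  interpret Ionescu_Tulcea "state_kernel E q" "\<lambda>_. count_space UNIV"
    by (rule Ionescu_Tulcea_state_kernel)
  show ?thesis by (simp add: trajectories_def)
qed

lemma prob_space_trajectories: "prob_space (trajectories E q)"
proof -
  interpret Ionescu_Tulcea "state_kernel E q" "\<lambda>_. count_space UNIV"
    by (rule Ionescu_Tulcea_state_kernel)
  interpret CI: prob_space "CI {}"
    by (rule PF.prob_space_P) auto
  have "emeasure PF.lim (PF.emb UNIV {} (space (CI {}))) = 1"
    using lim[of "{}" "space (CI {})"] CI.emeasure_space_1 by (simp add: CI_def)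
  moreover have "PF.emb UNIV {} (space (CI {})) = space PF.lim"
    by (auto simp: CI_def prod_emb_def space_PiM)
  ultimately show ?thesis
    unfolding trajectories_def by (intro prob_spaceI) simp
qed

lemma emeasure_trajectories:
  "emeasure (trajectories E q) {\<omega>. \<forall>u\<le>t. \<omega> u = s u} =
    ennreal (pmf (init E) (s 0) * (\<Prod>u<t. pmf (state_step E q (s u)) (s (Suc u))))"
proof -
  interpret Ionescu_Tulcea "state_kernel E q" "\<lambda>_. count_space UNIV"
    by (rule Ionescu_Tulcea_state_kernel)
  let ?X = "\<lambda>n. PiE {0..<n} (\<lambda>u. {s u})"
  have X[measurable]: "?X n \<in> sets (PiM {0..<n} (\<lambda>_. count_space UNIV))" for n
    by (intro sets_PiM_I_finite) auto
  have C: "emeasure (C 0 n (\<lambda>_. undefined)) (?X n) =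
      (\<Prod>u<n. ennreal (pmf (case u of 0 \<Rightarrow> init E | Suc v \<Rightarrow> state_step E q (s v)) (s u)))" for n
  proof (induction n)
    case 0
    show ?case using X[of 0] by (simp add: emeasure_return)
  next
    case (Suc n)
    have sp: "(\<lambda>_. undefined) \<in> space (PiM {0..<0::nat} (\<lambda>_. count_space UNIV))"
      by (simp add: space_PiM)
    let ?c = "ennreal (pmf (case n of 0 \<Rightarrow> init E | Suc v \<Rightarrow> state_step E q (s v)) (s n))"
    have "emeasure (C 0 (Suc n) (\<lambda>_. undefined)) (?X (Suc n)) =
        (\<integral>\<^sup>+\<omega>. emeasure (eP n \<omega>) (?X (Suc n)) \<partial>C 0 n (\<lambda>_. undefined))"
      using measurable_eP[of n] sets_C[OF sp, of n] space_C[OF sp, of n]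
      by (simp, subst emeasure_bind[where N = "PiM {0..<Suc n} (\<lambda>_. count_space UNIV)"])
        (auto simp: space_PiM cong: measurable_cong_sets)
    also have "\<dots> = (\<integral>\<^sup>+\<omega>. ?c * indicator (?X n) \<omega> \<partial>C 0 n (\<lambda>_. undefined))"
    proof (rule nn_integral_cong)
      fix \<omega> assume "\<omega> \<in> space (C 0 n (\<lambda>_. undefined))"
      then have \<omega>: "\<omega> \<in> space (PiM {0..<n} (\<lambda>_. count_space UNIV))"
        using space_C[OF sp, of n] by simp
      then have ext: "\<omega> \<in> extensional {0..<n}"
        by (simp add: space_PiM PiE_def)
      have vimage: "(\<lambda>x. fun_upd \<omega> n x) -` ?X (Suc n) = (if \<omega> \<in> ?X n then {s n} else {})"
        using ext by (auto simp: PiE_iff extensional_def less_Suc_eq split: if_splits)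
      have "emeasure (eP n \<omega>) (?X (Suc n)) = emeasure (state_kernel E q n \<omega>)
          (if \<omega> \<in> ?X n then {s n} else {})"
        using emeasure_eP[OF \<omega>, of "?X (Suc n)"] X[of "Suc n"] vimage by simp
      also have "\<dots> = ?c * indicator (?X n) \<omega>"
        by (auto simp: state_kernel_def emeasure_pmf_single PiE_iff split: nat.split)
      finally show "emeasure (eP n \<omega>) (?X (Suc n)) = ?c * indicator (?X n) \<omega>" .
    qed
    also have "\<dots> = ?c * emeasure (C 0 n (\<lambda>_. undefined)) (?X n)"
      using sets_C[OF sp, of n] by (intro nn_integral_cmult_indicator) simp
    finally show ?case
      using Suc.IH by (simp add: mult.commute)
  qed
  have "{\<omega>. \<forall>u\<le>t. \<omega> u = s u} = PF.emb UNIV {0..<Suc t} (?X (Suc t))"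
    by (auto simp: prod_emb_def space_PiM PiE_iff less_Suc_eq_le)
  then have "emeasure (trajectories E q) {\<omega>. \<forall>u\<le>t. \<omega> u = s u} = emeasure (CI {0..<Suc t}) (?X (Suc t))"
    unfolding trajectories_def by (simp add: lim)
  also have "\<dots> = emeasure (C 0 (Suc t) (\<lambda>_. undefined)) (?X (Suc t))"
  proof -
    have "PF.emb {0..<Suc t} {0..<Suc t} (?X (Suc t)) = ?X (Suc t)"
      by (rule prod_emb_id) (auto simp: PiE_iff)
    then show ?thesis
      using emeasure_CI[of "{0..<Suc t}" "Suc t" "?X (Suc t)"] X[of "Suc t"] by (simp only: subset_refl)
  qed
  also note C
  finally show ?thesis
    by (simp add: prod.lessThan_Suc_shift prod_ennreal prod_nonneg ennreal_mult del: C.simps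
        prod.lessThan_Suc)
qed


section \<open>Multi-agent path finding\<close>

record ('n, 's, 'a, 'o, 'v) mapf = "('n, 's, 'a, 'o) dec_pomdp" +
  edges :: "'v rel"
  position :: "'s \<Rightarrow> 'n \<Rightarrow> 'v"
  goal :: "'s \<Rightarrow> 'n \<Rightarrow> 'v"

definition moves_on_graph :: "('n, 's, 'a, 'o, 'v) mapf \<Rightarrow> bool" where
  "moves_on_graph E \<longleftrightarrow>
    sym (edges E) \<and>
    (\<forall>s a. \<forall>s' \<in> set_pmf (trans E s a). \<forall>i.
      position E s' i = position E s i \<or> (position E s i, position E s' i) \<in> edges E)"

definition one_shot :: "('n, 's, 'a, 'o, 'v) mapf \<Rightarrow> bool" where
  "one_shot E \<longleftrightarrow>
    moves_on_graph E \<and>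
    (\<forall>s a. \<forall>s' \<in> set_pmf (trans E s a). \<forall>i. goal E s' i = goal E s i)"

text \<open>
  Agent \<open>i\<close> reaches its goal in the transition from \<open>s\<close> to \<open>s'\<close> if its new position is the goal
  it had in \<open>s\<close>; the goal stored in \<open>s'\<close> is then already the next one. Since goals are replaced
  immediately, no agent stands on its current goal at the start.
\<close>

definition lifelong :: "('n, 's, 'a, 'o, 'v) mapf \<Rightarrow> bool" where
  "lifelong E \<longleftrightarrow>
    moves_on_graph E \<and>
    (\<forall>s \<in> set_pmf (init E). \<forall>i. position E s i \<noteq> goal E s i) \<and>
    (\<forall>s a. \<forall>s' \<in> set_pmf (trans E s a). \<forall>i.
      if position E s' i = goal E s i then goal E s' i \<noteq> goal E s i
      else goal E s' i = goal E s i)"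

text \<open>No two agents on one vertex, and no two agents exchanging their vertices.\<close>

definition collision_free :: "('n, 's, 'a, 'o, 'v) mapf \<Rightarrow> (nat \<Rightarrow> 's) \<Rightarrow> nat \<Rightarrow> bool" where
  "collision_free E \<omega> t \<longleftrightarrow>
    (\<forall>u\<le>t. inj (position E (\<omega> u))) \<and>
    (\<forall>u<t. \<not> (\<exists>i j. i \<noteq> j \<and>
       position E (\<omega> (Suc u)) i = position E (\<omega> u) j \<and>
       position E (\<omega> (Suc u)) j = position E (\<omega> u) i))"

text \<open>
  Goals count only if they are reached along collision-free paths, so that both environments that
  rule out collisions and environments that leave this to the policy are covered. The makespan of
  a trajectory that never solves the instance is \<open>\<infinity>\<close>.
\<close>

definition makespan :: "('n, 's, 'a, 'o, 'v) mapf \<Rightarrow> (nat \<Rightarrow> 's) \<Rightarrow> ennreal" where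
  "makespan E \<omega> =
    (INF t \<in> {t. (\<forall>i. position E (\<omega> t) i = goal E (\<omega> t) i) \<and> collision_free E \<omega> t}. of_nat t)"

definition throughput ::
  "('n::finite, 's, 'a, 'o, 'v) mapf \<Rightarrow> nat \<Rightarrow> (nat \<Rightarrow> 's) \<Rightarrow> ennreal" where
  "throughput E T \<omega> =
    of_nat (\<Sum>t<T. card {i. position E (\<omega> (Suc t)) i = goal E (\<omega> t) i \<and>
                             collision_free E \<omega> (Suc t)}) / of_nat T"

definition expected_makespan ::
  "('n, 's, 'a, 'o, 'v) mapf \<Rightarrow> ('n, 'a, 'o) joint_policy \<Rightarrow> ennreal" where
  "expected_makespan E q = (\<integral>\<^sup>+ \<omega>. makespan E \<omega> \<partial>trajectories E q)"

definition expected_throughput ::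
  "('n::finite, 's, 'a, 'o, 'v) mapf \<Rightarrow> nat \<Rightarrow> ('n, 'a, 'o) joint_policy \<Rightarrow> ennreal" where
  "expected_throughput E T q = (\<integral>\<^sup>+ \<omega>. throughput E T \<omega> \<partial>trajectories E q)"

text \<open>On a countable graph both quantities are random variables, whatever the state set is.\<close>

lemma measurable_position_trajectories [measurable]:
  "(\<lambda>\<omega>. position E (\<omega> t) i) \<in> measurable (PiM UNIV (\<lambda>_. count_space UNIV)) (count_space UNIV)"
  by (rule measurable_compose[OF measurable_component_singleton]) auto

lemma measurable_goal_trajectories [measurable]:
  "(\<lambda>\<omega>. goal E (\<omega> t) i) \<in> measurable (PiM UNIV (\<lambda>_. count_space UNIV)) (count_space UNIV)"
  by (rule measurable_compose[OF measurable_component_singleton]) auto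

lemma measurable_collision_free [measurable]:
  fixes E :: "('n::finite, 's, 'a, 'o, 'v::countable) mapf"
  shows "Measurable.pred (PiM UNIV (\<lambda>_. count_space UNIV)) (\<lambda>\<omega>. collision_free E \<omega> t)"
  unfolding collision_free_def inj_def by measurable

lemma measurable_makespan:
  fixes E :: "('n::finite, 's, 'a, 'o, 'v::countable) mapf"
  shows "makespan E \<in> borel_measurable (trajectories E q)"
proof -
  have "makespan E = (\<lambda>\<omega>. INF t. if (\<forall>i. position E (\<omega> t) i = goal E (\<omega> t) i) \<and>
      collision_free E \<omega> t then of_nat t else \<top>)" (is "_ = (\<lambda>\<omega>. INF t. ?g \<omega> t)")
  proof
    fix \<omega>
    show "makespan E \<omega> = (INF t. ?g \<omega> t)"
      unfolding makespan_def
    proof (rule antisym)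
      show "(INF t \<in> {t. (\<forall>i. position E (\<omega> t) i = goal E (\<omega> t) i) \<and> collision_free E \<omega> t}. of_nat t)
          \<le> (INF t. ?g \<omega> t)"
        by (rule INF_greatest) (auto intro: INF_lower)
      show "(INF t. ?g \<omega> t)
          \<le> (INF t \<in> {t. (\<forall>i. position E (\<omega> t) i = goal E (\<omega> t) i) \<and> collision_free E \<omega> t}. of_nat t)"
      proof (rule INF_greatest)
        fix t
        assume t: "t \<in> {t. (\<forall>i. position E (\<omega> t) i = goal E (\<omega> t) i) \<and> collision_free E \<omega> t}"
        have "(INF t. ?g \<omega> t) \<le> ?g \<omega> t"
          by (rule INF_lower) simp
        with t show "(INF t. ?g \<omega> t) \<le> of_nat t" by simp
      qed
    qed
  qed
  also have "\<dots> \<in> borel_measurable (trajectories E q)"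
    by measurable
  finally show ?thesis .
qed

lemma measurable_throughput:
  fixes E :: "('n::finite, 's, 'a, 'o, 'v::countable) mapf"
  shows "throughput E T \<in> borel_measurable (trajectories E q)"
proof -
  have "throughput E T = (\<lambda>\<omega>. (\<Sum>t<T. \<Sum>i\<in>UNIV.
      if position E (\<omega> (Suc t)) i = goal E (\<omega> t) i \<and> collision_free E \<omega> (Suc t)
      then 1 else 0) / of_nat T)"
    unfolding throughput_def by (simp add: fun_eq_iff sum.If_cases)
  also have "\<dots> \<in> borel_measurable (trajectories E q)"
    by measurable
  finally show ?thesis .
qed

end

theory Submission
  imports Defs
begin

text \<open>
  By the chain rule for conditional probabilities, every decision order reproduces the joint
  distribution whose conditionals the policy consists of. The conditionals are unconstrained after
  a history of probability zero, but there the product already contains a vanishing factor.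
\<close>

lemma prod_conditionals:
  assumes q: "conditionals_of q p" and "distinct is"
  shows "(\<Prod>k<length is. pmf (p obs (map (\<lambda>i. (i, a i)) (take k is)) (is ! k)) (a (is ! k))) =
    \<P>(b in q obs. \<forall>i\<in>set is. b i = a i)"
  using assms(2)
\<comment> \<open>The induction peels off the last agent, since the history in factor
  \<open>k\<close> is a prefix of the list: appending \<open>i\<close> leaves all earlier factors
  unchanged and adds one factor, with history \<open>?h\<close>.\<close>
proof (induction "is" rule: rev_induct)
  case Nil
  then show ?case by simp
next
  case (snoc i js)
  let ?h = "map (\<lambda>j. (j, a j)) js"
  let ?Q = "\<lambda>b. \<forall>j\<in>set js. b j = a j"
  let ?f = "\<lambda>is k. pmf (p obs (map (\<lambda>i. (i, a i)) (take k is)) (is ! k)) (a (is ! k))"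
  have "(\<Prod>k<length js. ?f (js @ [i]) k) = (\<Prod>k<length js. ?f js k)"
    by (intro prod.cong) (auto simp: nth_append)
  also have "\<dots> = \<P>(b in q obs. ?Q b)"
    using snoc by simp
  finally have "(\<Prod>k<length (js @ [i]). ?f (js @ [i]) k) =
      \<P>(b in q obs. ?Q b) * pmf (p obs ?h i) (a i)"
    by simp
  also have "\<dots> = \<P>(b in q obs. b i = a i \<and> ?Q b)"
  \<comment> \<open>If \<open>?Q\<close> is a null event, so is its subset on the right, and both
    sides are 0. Otherwise positivity both triggers \<open>conditionals_of\<close> and lets the
    denominator of the conditional probability cancel.\<close>
  proof (cases "\<P>(b in q obs. ?Q b) = 0")
    case True
    have "\<P>(b in q obs. b i = a i \<and> ?Q b) \<le> \<P>(b in q obs. ?Q b)"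
      by (rule measure_pmf.finite_measure_mono) auto
    with True show ?thesis
      by (simp add: measure_le_0_iff)
  next
    case False
    have Q: "(\<forall>(j, y)\<in>set ?h. b j = y) \<longleftrightarrow> ?Q b" for b
      by auto
    have "distinct (map fst ?h)" "i \<notin> fst ` set ?h"
      using snoc.prems by (auto simp: comp_def)
    moreover have "\<P>(b in q obs. \<forall>(j, y)\<in>set ?h. b j = y) > 0"
      using False by (simp only: Q zero_less_measure_iff) simp
    ultimately have "pmf (p obs ?h i) (a i) = \<P>(b in q obs. b i = a i \<bar> ?Q b)"
      using q unfolding conditionals_of_def Q[symmetric] by blast
    with False show ?thesis
      by (simp add: cond_prob_def)
  qed
  also have "\<dots> = \<P>(b in q obs. \<forall>j\<in>set (js @ [i]). b j = a j)"
    by simp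
  finally show ?case .
qed

text \<open>The source of order invariance: \<open>q\<close> does not mention
  \<open>\<sigma>\<close>. A decision order lists every agent, so the chain rule ends with the
  probability of a fully specified joint action.\<close>

lemma autoregressive_eq_joint:
  fixes p :: "('n::finite, 'a, 'o) policy"
  assumes "conditionals_of q p" "\<sigma> \<in> permutations_of_set UNIV"
  shows "autoregressive p \<sigma> = q"
proof (intro ext pmf_eqI)
  fix obs a
  have \<sigma>: "distinct \<sigma>" "set \<sigma> = UNIV"
    using assms(2) by (auto simp: permutations_of_set_def)
  then have "length \<sigma> = CARD('n)"
    by (metis distinct_card)
  then have "pmf (autoregressive p \<sigma> obs) a = \<P>(b in q obs. \<forall>i\<in>set \<sigma>. b i = a i)"
    using prod_conditionals[OF assms(1) \<sigma>(1), of obs a]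
    pmf_autoregressive[OF assms(2), of p obs a]
    by (simp add: autoregressive_prob_def)
  \<comment> \<open>As \<open>set \<sigma> = UNIV\<close>, the event says \<open>b = a\<close>, so
    it is the singleton of \<open>a\<close>.\<close>
  also have "\<dots> = pmf (q obs) a"
    using \<sigma> by (simp add: fun_eq_iff[symmetric] measure_pmf_single)
  finally show "pmf (autoregressive p \<sigma> obs) a = pmf (q obs) a" .
qed

theorem proposition1:
  fixes \<pi> :: "'p \<Rightarrow> ('n::finite, 'a, 'o) policy"
  assumes "\<And>\<theta>. coherent (\<pi> \<theta>)"
  shows
    "(\<forall>\<theta>. \<forall>obs. \<forall>\<sigma>\<in>permutations_of_set UNIV. \<forall>\<nu>\<in>permutations_of_set UNIV.
        autoregressive (\<pi> \<theta>) \<sigma> obs = autoregressive (\<pi> \<theta>) \<nu> obs) \<and>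
     (\<forall>f :: ('n, 'a, 'o) joint_policy \<Rightarrow> ereal.
        \<forall>\<sigma>\<in>permutations_of_set UNIV. \<forall>\<nu>\<in>permutations_of_set UNIV.
        (SUP \<theta>. f (autoregressive (\<pi> \<theta>) \<sigma>)) = (SUP \<theta>. f (autoregressive (\<pi> \<theta>) \<nu>))) \<and>
     (\<forall>E :: ('n, 's, 'a, 'o, 'v::countable) mapf. one_shot E \<longrightarrow>
        (\<forall>\<sigma>\<in>permutations_of_set UNIV. \<forall>\<nu>\<in>permutations_of_set UNIV.
        (INF \<theta>. expected_makespan E (autoregressive (\<pi> \<theta>) \<sigma>)) =
        (INF \<theta>. expected_makespan E (autoregressive (\<pi> \<theta>) \<nu>)))) \<and>
     (\<forall>E :: ('n, 's, 'a, 'o, 'v::countable) mapf. \<forall>T\<ge>1. lifelong E \<longrightarrow>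
        (\<forall>\<sigma>\<in>permutations_of_set UNIV. \<forall>\<nu>\<in>permutations_of_set UNIV.
        (SUP \<theta>. expected_throughput E T (autoregressive (\<pi> \<theta>) \<sigma>)) =
        (SUP \<theta>. expected_throughput E T (autoregressive (\<pi> \<theta>) \<nu>))))"
proof -
  \<comment> \<open>Coherence gives a joint law for each parameter separately; choice collects them
    into one function of \<open>\<theta>\<close>.\<close>
  obtain q :: "'p \<Rightarrow> ('n, 'a, 'o) joint_policy" where "\<And>\<theta>. conditionals_of (q \<theta>) (\<pi> \<theta>)"
    using assms unfolding coherent_def by metis
  then have "autoregressive (\<pi> \<theta>) \<sigma> = q \<theta>" if "\<sigma> \<in> permutations_of_set UNIV" for \<theta> \<sigma>
    using that by (rule autoregressive_eq_joint)
  \<comment> \<open>Rewriting turns both sides of every equation, also below \<open>SUP\<close> and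
    \<open>INF\<close>, into the same expression in \<open>q \<theta>\<close>.\<close>
  then show ?thesis by simp
qed

end
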